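(* Let $G$ be a chemical $(n,m)$-graph with $n\ge5$. If $$a>\frac{\ln 3-\ln 4}{\ln(\ln 2)-\ln(\ln 3)}\ (\approx 0.6246),$$ then $$SLI_a(G)\le \frac{8(\ln4)^a}{3}\,m-\frac{4(\ln4)^a}{3}\,n+\begin{cases}\dfrac{2\big(3(\ln2)^a-2(\ln4)^a\big)}{3} & \text{if } 2m-n\equiv1\pmod 3,\\[2mm] \dfrac{9(\ln3)^a-8(\ln4)^a}{3} & \text{if } 2m-n\equiv2\pmod 3,\\[2mm] 0 & \text{if } 2m-n\equiv0\pmod 3,\end{cases}$$ with equality if and only if the degree set of $G$ is - $\{1,2,4\}$ and $G$ contains only one vertex of degree $2$, whenever $2m-n\equiv1\pmod 3$; - $\{1,3,4\}$ and $G$ contains only one vertex of degree $3$, whenever $2m-n\equiv2\pmod 3$; - $\{1,4\}$, whenever $2m-n\equiv0\pmod 3$.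
   Context: All graphs are finite, simple and connected. An $(n,m)$-graph is a graph with $n$ vertices and $m$ edges. A chemical graph is a (connected) graph of maximum degree at most $4$. $d_v$ denotes the degree of the vertex $v$. The degree set of $G$ is the set of distinct vertex degrees occurring in $G$. For real $a>0$, the variable sum lodeg index is $SLI_a(G)=\sum_{v\in V(G)}d_v(\ln d_v)^a$ (so vertices of degree $1$ contribute $0$).
   Formalization: The printed equality condition fails for graphs without vertices of degree 1 (e.g. K5); corrected so that the degree set may also be {4} when 2m-n≡0 (mod 3), and {2,4} with only one vertex of degree 2 when 2m-n≡1 (mod 3). *)

theory Defs
  imports Complex_Main "Graph_Theory.Digraph_Component"
begin

(* Finite simple graphs are the symmetric loop-free digraphs of the locale "graph" without
   parallel arcs.  An undirected edge is therefore a pair of opposite arcs, and the degree of a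
   vertex is its out-degree.  The name "connected" is also used for topological spaces. *)

definition edges :: "('a, 'b) pre_digraph \<Rightarrow> 'a set set" where
  "edges G = (\<lambda>e. {tail G e, head G e}) ` arcs G"

definition nm_graph :: "nat \<Rightarrow> nat \<Rightarrow> ('a, 'b) pre_digraph \<Rightarrow> bool" where
  "nm_graph n m G \<longleftrightarrow>
     graph G \<and> Digraph_Component.connected G \<and> card (verts G) = n \<and> card (edges G) = m"

abbreviation degree :: "('a, 'b) pre_digraph \<Rightarrow> 'a \<Rightarrow> nat" where
  "degree G v \<equiv> out_degree G v"

definition chemical :: "('a, 'b) pre_digraph \<Rightarrow> bool" where
  "chemical G \<longleftrightarrow> (\<forall>v \<in> verts G. degree G v \<le> 4)"

(* Exactly the degrees that occur: K5 has degree set {4}, and K5 with one edge subdivided has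
   degree set {2, 4}.  Both attain the bound below although they have no vertex of degree 1,
   so the equality characterization has to list these degree sets besides {1, 4}, {1, 2, 4}. *)
definition degree_set :: "('a, 'b) pre_digraph \<Rightarrow> nat set" where
  "degree_set G = degree G ` verts G"

(* A vertex of degree 1 contributes 0, because ln 1 = 0 and 0 powr a = 0. *)
definition SLI :: "real \<Rightarrow> ('a, 'b) pre_digraph \<Rightarrow> real" where
  "SLI a G = (\<Sum>v \<in> verts G. real (degree G v) * ln (real (degree G v)) powr a)"

(* The difference 2m - n is taken in the integers. *)
definition SLI_bound :: "real \<Rightarrow> nat \<Rightarrow> nat \<Rightarrow> real" where
  "SLI_bound a n m =
     8 * ln 4 powr a / 3 * real m - 4 * ln 4 powr a / 3 * real n +
     (if (2 * int m - int n) mod 3 = 1 then 2 * (3 * ln 2 powr a - 2 * ln 4 powr a) / 3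
      else if (2 * int m - int n) mod 3 = 2 then (9 * ln 3 powr a - 8 * ln 4 powr a) / 3
      else 0)"

end

theory Submission
  imports Defs
begin

text \<open>
  Write \<open>n\<^sub>k\<close> for the number of vertices of degree \<open>k\<close> and \<open>L\<^sub>k = (ln k)\<^sup>a\<close>. All degrees lie between
  1 and 4, so counting vertices and edge ends gives \<open>2m - n = n\<^sub>2 + 2n\<^sub>3 + 3n\<^sub>4\<close>. Eliminating \<open>n\<^sub>4\<close> from
  \<open>SLI = 2 L\<^sub>2 n\<^sub>2 + 3 L\<^sub>3 n\<^sub>3 + 4 L\<^sub>4 n\<^sub>4\<close> leaves
  \<open>SLI = 4/3 L\<^sub>4 (2m - n) - p n\<^sub>2 - q n\<^sub>3\<close> with \<open>p = 4/3 L\<^sub>4 - 2 L\<^sub>2\<close> and \<open>q = 8/3 L\<^sub>4 - 3 L\<^sub>3\<close>,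
  and the three constants in the bound are \<open>-p\<close>, \<open>-q\<close> and 0. So the task is to minimise the penalty
  \<open>p n\<^sub>2 + q n\<^sub>3\<close> when only the residue \<open>n\<^sub>2 - n\<^sub>3 \<equiv> 2m - n\<close> modulo 3 is known. A single vertex of
  degree 2 (or 3) is the cheapest way to realise residue 1 (or 2), provided that two vertices of
  the other kind, which realise the same residue, cost more: \<open>p < 2q\<close> and \<open>q < 2p\<close>
  (lemma \<open>min_penalty\<close>). These two inequalities also force \<open>p\<close> and \<open>q\<close> to be positive.

  The inequality \<open>q < 2p\<close> says \<open>4 L\<^sub>2 < 3 L\<^sub>3\<close>, which is exactly the hypothesis on \<open>a\<close>. The
  inequality \<open>p < 2q\<close> says \<open>3 L\<^sub>3 < 2 L\<^sub>4 + L\<^sub>2\<close>; it holds for every \<open>a > 0\<close> by the inequality between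
  arithmetic and geometric mean, because \<open>(ln 3)\<^sup>3 < (ln 4)\<^sup>2 ln 2\<close>.

  Finally the minimisers \<open>(n\<^sub>2, n\<^sub>3)\<close> are turned into degree sets. Connectedness, which already
  excludes vertices of degree 0, is used here a second time: the bound \<open>n \<le> m + 1\<close> (lemma
  \<open>connected_imp_card_verts_le\<close>) shows that an extremal graph on at least five vertices has a vertex
  of degree 4 (lemma \<open>degree_set_iff_degree_counts\<close>).
\<close>

section \<open>Counting in connected graphs\<close>

lemma (in graph) card_arcs_eq_twice_card_edges: "card (arcs G) = 2 * card (edges G)"
proof -
  let ?ends = "\<lambda>e. {tail G e, head G e}"
  have fibre: "card {e \<in> arcs G. ?ends e = E} = 2" if E: "E \<in> edges G" for E
  proof -
    obtain e where e: "e \<in> arcs G" "E = ?ends e"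
      using E by (auto simp: edges_def)
    obtain e' where e': "e' \<in> arcs G" "tail G e = head G e'" "head G e = tail G e'"
      using sym_arcs e(1) unfolding symmetric_conv by blast
    have ne: "tail G e \<noteq> head G e"
      using no_loops e(1) by blast
    have "{x \<in> arcs G. ?ends x = E} = {e, e'}"
    proof (intro equalityI subsetI)
      fix x assume x: "x \<in> {x \<in> arcs G. ?ends x = E}"
      then have "arc_to_ends G x = arc_to_ends G e \<or> arc_to_ends G x = arc_to_ends G e'"
        using e e' by (auto simp: arc_to_ends_def doubleton_eq_iff)
      then show "x \<in> {e, e'}"
        using x e e' no_multi_arcs by blast
    qed (use e e' in auto)
    moreover have "e \<noteq> e'"
      using ne e' by auto
    ultimately show ?thesis
      by simp
  qed
  have "card (arcs G) = (\<Sum>E \<in> edges G. card {e \<in> arcs G. ?ends e = E})"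
    using sum.image_gen[of "arcs G" "\<lambda>_. 1::nat" ?ends] by (simp add: edges_def)
  also have "\<dots> = 2 * card (edges G)"
    by (simp add: fibre)
  finally show ?thesis .
qed

lemma (in fin_digraph) sum_out_degree_eq_card_arcs:
  "(\<Sum>v \<in> verts G. out_degree G v) = card (arcs G)"
proof -
  have "(\<Sum>v \<in> verts G. out_degree G v) = (\<Sum>v \<in> verts G. \<Sum>e \<in> {e \<in> arcs G. tail G e = v}. 1)"
    by (simp add: out_degree_def out_arcs_def)
  also have "\<dots> = (\<Sum>e \<in> arcs G. 1)"
    by (rule sum.group) auto
  finally show ?thesis
    by simp
qed

lemma (in wf_digraph) reachable_imp_leaving_arc:
  assumes "u \<rightarrow>\<^sup>* v" "u \<in> S" "v \<notin> S"
  obtains e where "e \<in> arcs G" "tail G e \<in> S" "head G e \<notin> S"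
proof -
  have "u \<in> S \<longrightarrow> (\<exists>e \<in> arcs G. tail G e \<in> S \<and> head G e \<notin> S)"
    using assms(1)
  proof (induct rule: converse_reachable_induct)
    case base
    then show ?case using assms(3) by simp
  next
    case (step x y)
    then show ?case by (cases "y \<in> S") (auto simp: arcs_ends_conv)
  qed
  then show thesis
    using assms(2) that by blast
qed

lemma (in graph) connected_imp_leaving_arc:
  assumes "Digraph_Component.connected G" "S \<subseteq> verts G" "S \<noteq> {}" "S \<noteq> verts G"
  obtains e where "e \<in> arcs G" "tail G e \<in> S" "head G e \<notin> S"
proof -
  obtain u v where "u \<in> S" "v \<in> verts G" "v \<notin> S"
    using assms(2-4) by auto
  moreover have "u \<rightarrow>\<^sup>* v"
    using symmetric_connected_imp_strongly_connected[OF sym_arcs assms(1)] calculation assms(2)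
    by (auto simp: strongly_connected_def)
  ultimately show thesis
    using reachable_imp_leaving_arc that by blast
qed

lemma (in graph) connected_imp_degree_pos:
  assumes "Digraph_Component.connected G" "2 \<le> card (verts G)" "v \<in> verts G"
  shows "0 < degree G v"
proof -
  have "{v} \<noteq> verts G"
  proof
    assume "{v} = verts G"
    then have "card (verts G) = card {v}"
      by simp
    then show False
      using assms(2) by simp
  qed
  then obtain e where "e \<in> arcs G" "tail G e = v"
    using connected_imp_leaving_arc[OF assms(1), of "{v}"] assms(3) by auto
  then have "e \<in> out_arcs G v"
    by simp
  then show ?thesis
    unfolding out_degree_def using finite_out_arcs card_gt_0_iff by blast
qed

text \<open>
  A vertex set that is not everything can be enlarged along an arc that leaves it, and the edge of
  that arc does not lie in the old set. So a set of \<open>k + 1\<close> vertices grown in this way spans at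
  least \<open>k\<close> edges.
\<close>
lemma (in graph) connected_imp_card_verts_le:
  assumes "Digraph_Component.connected G" "verts G \<noteq> {}"
  shows "card (verts G) \<le> card (edges G) + 1"
proof -
  have fin: "finite (edges G)"
    by (simp add: edges_def)
  have grow: "\<exists>S. S \<subseteq> verts G \<and> card S = Suc k \<and> k \<le> card {E \<in> edges G. E \<subseteq> S}"
    if "Suc k \<le> card (verts G)" for k
    using that
  proof (induction k)
    case 0
    then show ?case
      using assms(2) by (metis card_1_singleton_iff One_nat_def empty_subsetI ex_in_conv
          insert_subset le0)
  next
    case (Suc k)
    then obtain S where S: "S \<subseteq> verts G" "card S = Suc k" "k \<le> card {E \<in> edges G. E \<subseteq> S}"
      by auto
    have "finite S" "S \<noteq> {}" "S \<noteq> verts G"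
      using S(2) Suc.prems card_ge_0_finite[of S] by auto
    then obtain e where e: "e \<in> arcs G" "tail G e \<in> S" "head G e \<notin> S"
      using connected_imp_leaving_arc[OF assms(1) S(1)] by blast
    let ?T = "insert (head G e) S"
    have "Suc k \<le> card (insert {tail G e, head G e} {E \<in> edges G. E \<subseteq> S})"
      using S(3) e fin by (subst card_insert_disjoint) auto
    also have "\<dots> \<le> card {E \<in> edges G. E \<subseteq> ?T}"
      using fin e by (intro card_mono) (auto simp: edges_def)
    finally have "Suc k \<le> card {E \<in> edges G. E \<subseteq> ?T}" .
    moreover have "?T \<subseteq> verts G" "card ?T = Suc (Suc k)"
      using S e \<open>finite S\<close> by auto
    ultimately show ?case
      by blast
  qed
  have "0 < card (verts G)"
    using assms(2) by (simp add: card_gt_0_iff)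
  then obtain k where k: "card (verts G) = Suc k"
    by (metis gr0_conv_Suc)
  then obtain S where "k \<le> card {E \<in> edges G. E \<subseteq> S}"
    using grow[of k] by auto
  also have "\<dots> \<le> card (edges G)"
    using fin by (intro card_mono) auto
  finally show ?thesis
    using k by simp
qed

definition degree_count :: "('a, 'b) pre_digraph \<Rightarrow> nat \<Rightarrow> nat" where
  "degree_count G k = card {v \<in> verts G. degree G v = k}"

lemma sum_degree_eq_sum_degree_count:
  fixes f :: "nat \<Rightarrow> 'c :: comm_semiring_1"
  assumes "finite (verts G)" and "degree G ` verts G \<subseteq> {1..4}"
  shows "(\<Sum>v \<in> verts G. f (degree G v)) =
    of_nat (degree_count G 1) * f 1 + of_nat (degree_count G 2) * f 2 +
    of_nat (degree_count G 3) * f 3 + of_nat (degree_count G 4) * f 4"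
proof -
  have "(\<Sum>v \<in> verts G. f (degree G v)) =
      (\<Sum>k \<in> {1..4}. \<Sum>v \<in> {v \<in> verts G. degree G v = k}. f (degree G v))"
    by (rule sum.group[symmetric]) (use assms in auto)
  also have "\<dots> = (\<Sum>k \<in> {1..4}. of_nat (degree_count G k) * f k)"
    by (simp add: degree_count_def)
  also have "{1..4} = {1, 2, 3, 4::nat}"
    by auto
  finally show ?thesis
    by (simp add: add_ac)
qed

section \<open>The penalty of vertices of degree 2 and 3\<close>

lemma penalty_residue_one:
  fixes x y :: nat and p q :: real
  assumes "0 < p" "0 < q" "p < 2 * q"
    and "(int x - int y) mod 3 = 1" and "\<not> (x = 1 \<and> y = 0)"
  shows "p < p * real x + q * real y"
proof (cases x)
  case 0
  \<comment> \<open>Without any \<open>x\<close>, the residue 1 needs at least two \<open>y\<close>.\<close>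
  then have "2 \<le> y"
    using assms(4) by simp presburger
  then have "q * 2 \<le> q * real y"
    using assms(2) by (intro mult_left_mono) auto
  then show ?thesis
    using 0 assms(3) by simp
next
  case (Suc k)
  then have "0 < k \<or> 0 < y"
    using assms(5) by auto
  then have "0 < p * real k + q * real y"
    using assms(1,2) by (auto intro: add_pos_nonneg add_nonneg_pos)
  then show ?thesis
    using Suc by (simp add: algebra_simps)
qed

text \<open>
  The penalties \<open>p\<close> and \<open>q\<close> are positive, so every residue is realised most cheaply with few
  vertices: none for 0, and one for 1 or 2, where the only serious competitor is a pair of
  vertices of the other kind.
\<close>
lemma min_penalty:
  fixes x y :: nat and p q :: real
  defines "r \<equiv> (int x - int y) mod 3"
  defines "c \<equiv> (if r = 1 then p else if r = 2 then q else 0)"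
  assumes "p < 2 * q" "q < 2 * p"
  shows "c \<le> p * real x + q * real y"
    and "p * real x + q * real y = c \<longleftrightarrow>
      (r = 1 \<longrightarrow> x = 1 \<and> y = 0) \<and> (r = 2 \<longrightarrow> x = 0 \<and> y = 1) \<and> (r = 0 \<longrightarrow> x = 0 \<and> y = 0)"
proof -
  let ?P = "p * real x + q * real y"
  have pos: "0 < p" "0 < q"
    using assms(3,4) by auto
  consider "r = 0" | "r = 1" | "r = 2"
    unfolding r_def by linarith
  then have "c \<le> ?P \<and> (?P = c \<longleftrightarrow>
      (r = 1 \<longrightarrow> x = 1 \<and> y = 0) \<and> (r = 2 \<longrightarrow> x = 0 \<and> y = 1) \<and> (r = 0 \<longrightarrow> x = 0 \<and> y = 0))"
  proof cases
    case 1
    have "0 \<le> p * real x" "0 \<le> q * real y"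
      using pos by auto
    then show ?thesis
      using 1 pos by (auto simp: c_def add_nonneg_eq_0_iff)
  next
    case 2
    then show ?thesis
      using penalty_residue_one[OF pos assms(3), of x y] unfolding r_def c_def
      by (cases "x = 1 \<and> y = 0") auto
  next
    case 3
    \<comment> \<open>Exchanging the two kinds of vertices negates the residue, so this is the previous case.\<close>
    then have "(int y - int x) mod 3 = 1"
      unfolding r_def by presburger
    then show ?thesis
      using penalty_residue_one[OF pos(2,1) assms(4), of y x] 3 unfolding c_def
      by (cases "x = 0 \<and> y = 1") auto
  qed
  then show "c \<le> ?P" and "?P = c \<longleftrightarrow>
      (r = 1 \<longrightarrow> x = 1 \<and> y = 0) \<and> (r = 2 \<longrightarrow> x = 0 \<and> y = 1) \<and> (r = 0 \<longrightarrow> x = 0 \<and> y = 0)"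
    by auto
qed

section \<open>Powers of logarithms\<close>

lemma ln_4_eq: "ln 4 = 2 * (ln 2 :: real)"
  using ln_realpow[of "2::real" 2] by simp

text \<open>
  The two sides differ by less than one per cent. The fraction \<open>46/29\<close> separates \<open>ln 3 / ln 2\<close>
  from the cube root of 4.
\<close>
lemma ln_3_cubed_less: "(ln 3)^3 < (ln 4)^2 * (ln 2 :: real)"
proof -
  have pos: "0 < ln (2::real)" "0 < ln (3::real)"
    by simp_all
  have "ln ((3::real)^29) < ln (2^46)"
    by (subst ln_less_cancel_iff) simp_all
  moreover have "ln ((3::real)^29) = 29 * ln 3" "ln ((2::real)^46) = 46 * ln 2"
    by (subst ln_realpow; simp)+
  ultimately have "29 * ln 3 < 46 * ln (2::real)"
    by linarith
  then have "(29 * ln 3)^3 < (46 * ln (2::real))^3"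
    using pos by (intro power_strict_mono) auto
  then have "24389 * (ln 3)^3 < 97336 * (ln (2::real))^3"
    by (simp add: power_mult_distrib)
  moreover have "0 < (ln (2::real))^3"
    using pos by simp
  ultimately have "(ln 3)^3 < 4 * (ln (2::real))^3"
    by linarith
  then show ?thesis
    by (simp add: ln_4_eq power2_eq_square power3_eq_cube)
qed

text \<open>
  The weighted arithmetic-geometric mean inequality for \<open>L\<^sub>4, L\<^sub>4, L\<^sub>2\<close>, proved by replacing the
  exponential function by its tangent at \<open>a ln (ln 3)\<close>.
\<close>
lemma ln_powr_mean_less:
  fixes a :: real
  assumes "0 < a"
  shows "3 * ln 3 powr a < 2 * ln 4 powr a + ln 2 powr a"
proof -
  define s t w :: real where "s = ln (ln 2)" and "t = ln (ln 3)" and "w = ln (ln 4)"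
  have pos: "0 < ln (2::real)" "0 < ln (3::real)" "0 < ln (4::real)"
    by simp_all
  have powr_eq: "ln 2 powr a = exp (a * s)" "ln 3 powr a = exp (a * t)" "ln 4 powr a = exp (a * w)"
    by (simp_all add: powr_def s_def t_def w_def)
  have "ln ((ln (3::real))^3) < ln ((ln 4)^2 * ln 2)"
    using ln_3_cubed_less pos by (subst ln_less_cancel_iff) auto
  then have "3 * t < 2 * w + s"
    using pos by (simp add: s_def t_def w_def ln_mult_pos ln_realpow)
  then have gap: "0 < a * (2 * w + s - 3 * t)"
    using assms by simp
  have tangent: "exp (a * t) * (1 + (a * z - a * t)) \<le> exp (a * z)" for z
  proof -
    have "exp (a * t) * (1 + (a * z - a * t)) \<le> exp (a * t) * exp (a * z - a * t)"
      by (intro mult_left_mono exp_ge_add_one_self) auto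
    then show ?thesis
      by (simp flip: exp_add)
  qed
  have "exp (a * t) * 3 < exp (a * t) * (3 + a * (2 * w + s - 3 * t))"
    using gap by (intro mult_strict_left_mono) auto
  also have "\<dots> = 2 * (exp (a * t) * (1 + (a * w - a * t))) + exp (a * t) * (1 + (a * s - a * t))"
    by (simp add: algebra_simps)
  also have "\<dots> \<le> 2 * exp (a * w) + exp (a * s)"
    using tangent[of w] tangent[of s] by linarith
  finally show ?thesis
    by (simp add: powr_eq mult.commute)
qed

lemma
  fixes a :: real
  assumes "a > (ln 3 - ln 4) / (ln (ln 2) - ln (ln 3))"
  shows threshold_imp_pos: "0 < a"
    and threshold_imp_ln_powr_less: "4 * ln 2 powr a < 3 * ln 3 powr a"
proof -
  have less: "ln (ln 2) < ln (ln (3::real))"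
    by simp
  have "0 < (ln 3 - ln 4) / (ln (ln 2) - ln (ln (3::real)))"
    using less by (intro divide_neg_neg) auto
  with assms show "0 < a"
    by linarith
  have "(ln 3 - ln 4) > a * (ln (ln 2) - ln (ln (3::real)))"
    using assms less by (simp add: divide_less_eq)
  then have "ln 4 + a * ln (ln 2) < ln 3 + a * ln (ln (3::real))"
    by (simp add: algebra_simps)
  then have "exp (ln 4 + a * ln (ln 2)) < exp (ln 3 + a * ln (ln (3::real)))"
    by simp
  then show "4 * ln 2 powr a < 3 * ln 3 powr a"
    by (simp add: exp_add powr_def)
qed

section \<open>The extremal graphs\<close>

text \<open>
  A graph with \<open>n\<^sub>4 = 0\<close> and \<open>(n\<^sub>2, n\<^sub>3)\<close> equal to \<open>(0, 0)\<close>, \<open>(1, 0)\<close> or \<open>(0, 1)\<close> has so few edges that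
  it has at most two, three or four vertices, respectively. If \<open>(n\<^sub>2, n\<^sub>3) = (0, 1)\<close>, then
  moreover \<open>n\<^sub>1 > 0\<close>, because the number of vertices of odd degree is even.
\<close>
lemma degree_set_iff_degree_counts:
  fixes G :: "('a, 'b) pre_digraph"
  assumes fin: "finite (verts G)" and deg: "degree G ` verts G \<subseteq> {1..4}"
    and n: "n = degree_count G 1 + degree_count G 2 + degree_count G 3 + degree_count G 4"
    and m: "2 * m = degree_count G 1 + 2 * degree_count G 2 + 3 * degree_count G 3 +
      4 * degree_count G 4"
    and conn: "n \<le> m + 1" and "5 \<le> n"
  shows "degree_count G 2 = 0 \<and> degree_count G 3 = 0 \<longleftrightarrow>
      degree_set G = {1, 4} \<or> degree_set G = {4}" (is ?zero)
    and "degree_count G 2 = 1 \<and> degree_count G 3 = 0 \<longleftrightarrow>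
      (degree_set G = {1, 2, 4} \<or> degree_set G = {2, 4}) \<and> degree_count G 2 = 1" (is ?one)
    and "degree_count G 2 = 0 \<and> degree_count G 3 = 1 \<longleftrightarrow>
      degree_set G = {1, 3, 4} \<and> degree_count G 3 = 1" (is ?two)
proof -
  have mem: "k \<in> degree_set G \<longleftrightarrow> degree_count G k \<noteq> 0" for k
    using fin by (auto simp: degree_set_def degree_count_def)
  have sub: "degree_set G \<subseteq> {1, 2, 3, 4}"
  proof
    fix k assume "k \<in> degree_set G"
    then have "k \<in> {1..4}"
      using deg by (auto simp: degree_set_def)
    then show "k \<in> {1, 2, 3, 4}"
      by auto
  qed
  have set_eq: "degree_set G = K \<longleftrightarrow> (\<forall>k \<in> {1, 2, 3, 4}. k \<in> K \<longleftrightarrow> degree_count G k \<noteq> 0)"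
    if "K \<subseteq> {1, 2, 3, 4}" for K
    using that sub mem by blast
  have sets: "degree_set G = {1, 4} \<longleftrightarrow> degree_count G 1 \<noteq> 0 \<and> degree_count G 2 = 0 \<and>
        degree_count G 3 = 0 \<and> degree_count G 4 \<noteq> 0"
    "degree_set G = {4} \<longleftrightarrow> degree_count G 1 = 0 \<and> degree_count G 2 = 0 \<and>
        degree_count G 3 = 0 \<and> degree_count G 4 \<noteq> 0"
    "degree_set G = {1, 2, 4} \<longleftrightarrow> degree_count G 1 \<noteq> 0 \<and> degree_count G 2 \<noteq> 0 \<and>
        degree_count G 3 = 0 \<and> degree_count G 4 \<noteq> 0"
    "degree_set G = {2, 4} \<longleftrightarrow> degree_count G 1 = 0 \<and> degree_count G 2 \<noteq> 0 \<and>
        degree_count G 3 = 0 \<and> degree_count G 4 \<noteq> 0"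
    "degree_set G = {1, 3, 4} \<longleftrightarrow> degree_count G 1 \<noteq> 0 \<and> degree_count G 2 = 0 \<and>
        degree_count G 3 \<noteq> 0 \<and> degree_count G 4 \<noteq> 0"
    by (subst set_eq; auto)+
  have four: "degree_count G 4 \<noteq> 0" if "degree_count G 2 + degree_count G 3 \<le> 1"
    using that n m conn \<open>5 \<le> n\<close> by linarith
  have one: "degree_count G 1 \<noteq> 0" if "degree_count G 2 = 0" "degree_count G 3 = 1"
  proof
    assume "degree_count G 1 = 0"
    then have "2 * m = 3 + 4 * degree_count G 4"
      using m that by simp
    then show False
      by presburger
  qed
  show ?zero
    unfolding sets using four by auto
  show ?one
    unfolding sets using four by auto
  show ?two
    unfolding sets using four one by auto
qed

theorem corollary3:
  fixes G :: "('a, 'b) pre_digraph" and n m :: nat and a :: real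
  assumes "nm_graph n m G" and "chemical G" and "n \<ge> 5"
    and "a > (ln 3 - ln 4) / (ln (ln 2) - ln (ln 3))"
  shows "SLI a G \<le> SLI_bound a n m \<and>
    (SLI a G = SLI_bound a n m \<longleftrightarrow>
      ((2 * int m - int n) mod 3 = 1 \<longrightarrow>
         (degree_set G = {1, 2, 4} \<or> degree_set G = {2, 4}) \<and>
         card {v \<in> verts G. degree G v = 2} = 1) \<and>
      ((2 * int m - int n) mod 3 = 2 \<longrightarrow>
         degree_set G = {1, 3, 4} \<and> card {v \<in> verts G. degree G v = 3} = 1) \<and>
      ((2 * int m - int n) mod 3 = 0 \<longrightarrow>
         degree_set G = {1, 4} \<or> degree_set G = {4}))"
proof -
  interpret graph G
    using assms(1) by (simp add: nm_graph_def)
  have conn: "Digraph_Component.connected G" and n: "card (verts G) = n" and m: "card (edges G) = m"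
    using assms(1) by (simp_all add: nm_graph_def)
  have deg: "degree G ` verts G \<subseteq> {1..4}"
    using connected_imp_degree_pos[OF conn] assms(2,3) n
    by (force simp: chemical_def Suc_le_eq)
  define n1 n2 n3 n4 where
    "n1 = degree_count G 1" and "n2 = degree_count G 2" and
    "n3 = degree_count G 3" and "n4 = degree_count G 4"
  note counts = n1_def[symmetric] n2_def[symmetric] n3_def[symmetric] n4_def[symmetric]
  note degree_sum = sum_degree_eq_sum_degree_count[OF finite_verts deg, unfolded counts]

  have n_eq: "n = n1 + n2 + n3 + n4"
    using degree_sum[of "\<lambda>_. 1::nat"] n by simp
  have m_eq: "2 * m = n1 + 2 * n2 + 3 * n3 + 4 * n4"
    using degree_sum[of "\<lambda>k. k"] sum_out_degree_eq_card_arcs card_arcs_eq_twice_card_edges m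
    by simp
  have "n \<le> m + 1"
    using connected_imp_card_verts_le[OF conn] n m assms(3) by fastforce
  note extremal = degree_set_iff_degree_counts[OF finite_verts deg, unfolded counts,
      OF n_eq m_eq this assms(3)]

  define L2 L3 L4 where "L2 = ln 2 powr a" and "L3 = ln 3 powr a" and "L4 = ln 4 powr a"
  define p q where "p = 4 * L4 / 3 - 2 * L2" and "q = 8 * L4 / 3 - 3 * L3"
  have p_less: "p < 2 * q"
    using ln_powr_mean_less[OF threshold_imp_pos[OF assms(4)]]
    by (simp add: p_def q_def L2_def L3_def L4_def)
  have q_less: "q < 2 * p"
    using threshold_imp_ln_powr_less[OF assms(4)] by (simp add: p_def q_def L2_def L3_def L4_def)

  define r where "r = (2 * int m - int n) mod 3"
  have "2 * int m - int n = (int n2 - int n3) + 3 * (int n3 + int n4)"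
    using n_eq arg_cong[OF m_eq, of int] by simp
  then have r_eq: "(int n2 - int n3) mod 3 = r"
    by (simp only: r_def mod_mult_self2)
  define c where "c = (if r = 1 then p else if r = 2 then q else 0)"
  have min: "c \<le> p * real n2 + q * real n3"
    and min_iff: "p * real n2 + q * real n3 = c \<longleftrightarrow>
      (r = 1 \<longrightarrow> n2 = 1 \<and> n3 = 0) \<and> (r = 2 \<longrightarrow> n2 = 0 \<and> n3 = 1) \<and> (r = 0 \<longrightarrow> n2 = 0 \<and> n3 = 0)"
    using min_penalty[OF p_less q_less, of n2 n3] unfolding r_eq c_def by auto

  have SLI: "SLI a G = 2 * L2 * real n2 + 3 * L3 * real n3 + 4 * L4 * real n4"
    using degree_sum[of "\<lambda>k. real k * ln (real k) powr a"]
    by (simp add: SLI_def L2_def L3_def L4_def)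
  have bound: "SLI_bound a n m = 4 * L4 / 3 * (2 * real m - real n) - c"
    by (simp add: SLI_bound_def c_def p_def q_def L2_def L3_def L4_def r_def field_simps)
  have "2 * real m - real n = real n2 + 2 * real n3 + 3 * real n4"
    using n_eq arg_cong[OF m_eq, of real] by simp
  then have diff: "SLI_bound a n m - SLI a G = p * real n2 + q * real n3 - c"
    unfolding bound SLI p_def q_def by (simp add: field_simps)
  have "SLI a G \<le> SLI_bound a n m"
    using diff min by linarith
  moreover have "SLI a G = SLI_bound a n m \<longleftrightarrow> p * real n2 + q * real n3 = c"
    using diff by linarith
  ultimately show ?thesis
    unfolding min_iff r_def extremal
    by (simp add: n2_def n3_def degree_count_def)
qed

end
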